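(* Let $\kappa_N$ be the control law of the linear model predictive control problem (with data $A,B,Q,R,P,N,x_{\min},x_{\max},u_{\min},u_{\max}$) defined in the context. Then $\kappa_N$ is equivalent to a finite-depth oblique decision tree with linear predictions at the leaf nodes. That is, there exist a finite depth $D$ and an oblique decision tree with linear predictions of depth $D$, with parameters $\theta=(\mathbf a,\mathbf b,\mathbf c,\mathbf d)$, such that $f_{\text{tree}}(\theta,x_0)=\kappa_N(x_0)$ for every state $x_0\in\mathbb{R}^n$ at which the MPC problem is feasible.
   Context: **MPC problem and control law.** Consider the discrete-time linear system $x(k+1)=Ax(k)+Bu(k)$ with $x(k)\in\mathbb{R}^n$, $u(k)\in\mathbb{R}^m$ and $(A,B)$ stabilizable. Let $N\ge 1$ be the horizon, let $Q,P$ be (symmetric) positive semidefinite, and let $R$ be (symmetric) positive definite. For an initial state $x_0$, the MPC problem is $$\min_{\mathbf u}\ \sum_{k=0}^{N-1}\big(x(k)^\top Qx(k)+u(k)^\top Ru(k)\big)+x(N)^\top Px(N)$$ subject to $x(k+1)=Ax(k)+Bu(k)$, $x(0)=x_0$, $x_{\min}\le x(k)\le x_{\max}$ for $k=0,\dots,N$, and $u_{\min}\le u(k)\le u_{\max}$ for $k=0,\dots,N-1$ (componentwise inequalities), where $\mathbf u=(u(0),\dots,u(N-1))$. For feasible $x_0$, let $\mathbf u^*(x_0)=\{u^*(0;x_0),\dots,u^*(N-1;x_0)\}$ be the optimal sequence. The MPC control law is $\kappa_N(x_0)=u^*(0;x_0)\in\mathbb{R}^m$. **Oblique decision tree with linear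 predictions (ODT-LP).** An ODT-LP of depth $D$ is a complete binary tree with $T=2^{D+1}-1$ nodes. Its branch nodes are $\mathcal T_B=\{1,\dots,\lfloor T/2\rfloor\}$ and its leaf nodes are $\mathcal T_L=\{\lfloor T/2\rfloor+1,\dots,T\}$. Each branch node $t$ carries a vector $a_t\in\mathbb{R}^n$ and a threshold $b_t\in\mathbb{R}$. An input $x\in\mathbb{R}^n$ at branch node $t$ goes to the left child if $a_t^\top x\le b_t$ and to the right child otherwise. Each leaf node $t$ carries $c_t\in\mathbb{R}^{n\times m}$ and $d_t\in\mathbb{R}^m$. If $x$, starting from the root, reaches leaf $t$, the output of the tree is $f_{\text{tree}}(\theta,x)=c_t^\top x+d_t$, where $\theta=(\mathbf a,\mathbf b,\mathbf c,\mathbf d)$ collects all parameters. *)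

theory Defs
  imports "HOL-Analysis.Analysis"
begin

definition pos_semidef :: "real^'n^'n \<Rightarrow> bool" where
  "pos_semidef M \<longleftrightarrow> transpose M = M \<and> (\<forall>x. 0 \<le> x \<bullet> (M *v x))"

definition pos_def :: "real^'n^'n \<Rightarrow> bool" where
  "pos_def M \<longleftrightarrow> transpose M = M \<and> (\<forall>x. x \<noteq> 0 \<longrightarrow> 0 < x \<bullet> (M *v x))"

definition schur_stable :: "real^'n^'n \<Rightarrow> bool" where
  "schur_stable M \<longleftrightarrow>
     (\<forall>l v. v \<noteq> 0 \<and> map_matrix complex_of_real M *v v = l *s v \<longrightarrow> cmod l < 1)"

definition stabilizable :: "real^'n^'n \<Rightarrow> real^'m^'n \<Rightarrow> bool" where
  "stabilizable A B \<longleftrightarrow> (\<exists>K :: real^'n^'m. schur_stable (A + B ** K))"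


primrec mpc_state ::
  "real^'n^'n \<Rightarrow> real^'m^'n \<Rightarrow> real^'n \<Rightarrow> (nat \<Rightarrow> real^'m) \<Rightarrow> nat \<Rightarrow> real^'n" where
  "mpc_state A B x0 u 0 = x0"
| "mpc_state A B x0 u (Suc k) = A *v mpc_state A B x0 u k + B *v u k"

definition mpc_cost ::
  "real^'n^'n \<Rightarrow> real^'m^'n \<Rightarrow> real^'n^'n \<Rightarrow> real^'m^'m \<Rightarrow> real^'n^'n \<Rightarrow> nat \<Rightarrow>
   real^'n \<Rightarrow> (nat \<Rightarrow> real^'m) \<Rightarrow> real" where
  "mpc_cost A B Q R P N x0 u =
     (\<Sum>k<N. mpc_state A B x0 u k \<bullet> (Q *v mpc_state A B x0 u k) + u k \<bullet> (R *v u k))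
     + mpc_state A B x0 u N \<bullet> (P *v mpc_state A B x0 u N)"

text \<open>
  Input sequences of length \<open>N\<close> are functions on \<open>{..<N}\<close> that are \<open>undefined\<close> elsewhere, so that
  each sequence has exactly one representative. The order \<open>\<le>\<close> on vectors is componentwise.
\<close>

definition mpc_feasible_inputs ::
  "real^'n^'n \<Rightarrow> real^'m^'n \<Rightarrow> nat \<Rightarrow> real^'n \<Rightarrow> real^'n \<Rightarrow> real^'m \<Rightarrow> real^'m \<Rightarrow>
   real^'n \<Rightarrow> (nat \<Rightarrow> real^'m) set" where
  "mpc_feasible_inputs A B N xmin xmax umin umax x0 =
     {u \<in> {..<N} \<rightarrow>\<^sub>E UNIV.
        (\<forall>k\<le>N. xmin \<le> mpc_state A B x0 u k \<and> mpc_state A B x0 u k \<le> xmax) \<and>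
        (\<forall>k<N. umin \<le> u k \<and> u k \<le> umax)}"

definition mpc_feasible ::
  "real^'n^'n \<Rightarrow> real^'m^'n \<Rightarrow> nat \<Rightarrow> real^'n \<Rightarrow> real^'n \<Rightarrow> real^'m \<Rightarrow> real^'m \<Rightarrow>
   real^'n \<Rightarrow> bool" where
  "mpc_feasible A B N xmin xmax umin umax x0 \<longleftrightarrow>
     mpc_feasible_inputs A B N xmin xmax umin umax x0 \<noteq> {}"

definition mpc_optimal ::
  "real^'n^'n \<Rightarrow> real^'m^'n \<Rightarrow> real^'n^'n \<Rightarrow> real^'m^'m \<Rightarrow> real^'n^'n \<Rightarrow> nat \<Rightarrow>
   real^'n \<Rightarrow> real^'n \<Rightarrow> real^'m \<Rightarrow> real^'m \<Rightarrow> real^'n \<Rightarrow> (nat \<Rightarrow> real^'m) \<Rightarrow> bool" where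
  "mpc_optimal A B Q R P N xmin xmax umin umax x0 =
     is_arg_min (mpc_cost A B Q R P N x0)
       (\<lambda>u. u \<in> mpc_feasible_inputs A B N xmin xmax umin umax x0)"

text \<open>
  If the problem is feasible, \<open>Q\<close> and \<open>P\<close> are positive semidefinite and \<open>R\<close> is positive definite,
  the cost is continuous and strictly convex in the inputs and the feasible set is compact and
  convex, so the optimal sequence exists and is unique.
\<close>

definition mpc_law ::
  "real^'n^'n \<Rightarrow> real^'m^'n \<Rightarrow> real^'n^'n \<Rightarrow> real^'m^'m \<Rightarrow> real^'n^'n \<Rightarrow> nat \<Rightarrow>
   real^'n \<Rightarrow> real^'n \<Rightarrow> real^'m \<Rightarrow> real^'m \<Rightarrow> real^'n \<Rightarrow> real^'m" where
  "mpc_law A B Q R P N xmin xmax umin umax x0 =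
     (THE u. mpc_optimal A B Q R P N xmin xmax umin umax x0 u) 0"


text \<open>
  Nodes are numbered level by level starting from the root \<open>1\<close>, so the left and right child of
  node \<open>t\<close> are \<open>2 * t\<close> and \<open>2 * t + 1\<close>. The parameters \<open>a\<close>, \<open>b\<close> matter only at branch
  nodes and \<open>c\<close>, \<open>d\<close> only at leaf nodes; their values at other indices are never used.
\<close>

definition odt_size :: "nat \<Rightarrow> nat" where
  "odt_size D = 2 ^ (D + 1) - 1"

definition odt_branch_nodes :: "nat \<Rightarrow> nat set" where
  "odt_branch_nodes D = {1..odt_size D div 2}"

definition odt_leaf_nodes :: "nat \<Rightarrow> nat set" where
  "odt_leaf_nodes D = {odt_size D div 2 + 1..odt_size D}"

function odt_descend ::
  "nat \<Rightarrow> (nat \<Rightarrow> real^'n) \<Rightarrow> (nat \<Rightarrow> real) \<Rightarrow> real^'n \<Rightarrow> nat \<Rightarrow> nat" where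
  "odt_descend D a b x t =
     (if t \<in> odt_branch_nodes D
      then odt_descend D a b x (if a t \<bullet> x \<le> b t then 2 * t else 2 * t + 1)
      else t)"
  by pat_completeness auto
termination
  by (relation "Wellfounded.measure (\<lambda>(D, a, b, x, t). odt_size D - t)")
    (auto simp: odt_branch_nodes_def)

declare odt_descend.simps [simp del]

lemma odt_descend_in_leaf_nodes:
  assumes "t \<in> odt_branch_nodes D \<union> odt_leaf_nodes D"
  shows "odt_descend D a b x t \<in> odt_leaf_nodes D"
  using assms
proof (induction D a b x t rule: odt_descend.induct)
  case (1 D a b x t)
  show ?case
  proof (cases "t \<in> odt_branch_nodes D")
    case True
    have "odd (odt_size D)"
      by (simp add: odt_size_def)
    with True have "(if a t \<bullet> x \<le> b t then 2 * t else 2 * t + 1)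
        \<in> odt_branch_nodes D \<union> odt_leaf_nodes D"
      by (auto simp: odt_branch_nodes_def odt_leaf_nodes_def elim!: oddE)
    with 1(1) True show ?thesis
      by (subst odt_descend.simps) simp
  next
    case False
    with 1(2) show ?thesis
      by (subst odt_descend.simps) simp
  qed
qed

definition odt_output ::
  "nat \<Rightarrow> (nat \<Rightarrow> real^'n) \<Rightarrow> (nat \<Rightarrow> real) \<Rightarrow> (nat \<Rightarrow> real^'m^'n) \<Rightarrow> (nat \<Rightarrow> real^'m) \<Rightarrow>
   real^'n \<Rightarrow> real^'m" where
  "odt_output D a b c d x =
     (let t = odt_descend D a b x 1 in transpose (c t) *v x + d t)"

end

theory Submission
  imports Defs "HOL-Library.Function_Algebras" "HOL-Library.Discrete_Functions"
begin

text \<open>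
  Eliminating the states turns the control problem into a quadratic program in the input sequence,
  with the initial state \<open>x\<close> as a parameter. Its cost is a quadratic form in the pair of \<open>x\<close> and
  the input sequence \<open>z\<close>, strictly convex in \<open>z\<close>, and its constraints are finitely many linear
  inequalities in the pair. At every feasible state compactness of the input box gives a minimiser,
  and strict convexity makes it unique.

  Sort the feasible states by the set \<open>A\<close> of constraints that hold with equality at the optimum. There
  are finitely many such sets, and each of them is treated without multipliers. A feasible pair
  \<open>p\<close> is optimal iff the cost does not decrease to first order along any direction that is
  admissible for the constraints active at \<open>p\<close>. For a fixed active set this is a family of linear
  inequalities in \<open>p\<close>, so the pairs (parameter, optimum) with active set \<open>A\<close> form a convex set
  (\<open>convex_optimal_graph\<close>). On the linear space of directions along which the constraints in \<open>A\<close>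
  are constant, the first-order condition is an equation. Together with the equations for \<open>A\<close>
  it defines an affine set that determines \<open>z\<close> from \<open>x\<close>, and the law \<open>x \<mapsto> z\<close> is therefore
  the restriction of one affine map (\<open>optimal_graph_affine_law\<close>).

  The feasible states are thus partitioned into finitely many convex sets with an affine law on each.
  These sets are in general neither open nor closed, so one hyperplane need not separate two of
  them. But after weak separation the same problem remains on the separating hyperplane, in a lower
  dimension, so finitely many threshold tests tell two disjoint convex sets apart
  (\<open>disjoint_convex_finite_tests\<close>). Finally, a complete tree whose \<open>i\<close>-th level carries the
  \<open>i\<close>-th test sends two states to the same leaf only if they agree on all tests
  (\<open>odt_of_finite_tests\<close>), so one affine prediction per leaf suffices.
\<close>

section \<open>Separating convex sets by finitely many threshold tests\<close>

definition same_tests :: "('a::real_inner \<times> real) set \<Rightarrow> 'a \<Rightarrow> 'a \<Rightarrow> bool" where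
  "same_tests H x y \<longleftrightarrow> (\<forall>(a, b)\<in>H. a \<bullet> x \<le> b \<longleftrightarrow> a \<bullet> y \<le> b)"

lemma same_tests_mono: "same_tests H x y \<Longrightarrow> G \<subseteq> H \<Longrightarrow> same_tests G x y"
  by (auto simp: same_tests_def)

text \<open>
  A hyperplane that separates weakly, tested from both sides, distinguishes all pairs except those
  with both points on it. Choosing its normal in the span of the differences \<open>y - x\<close> ensures that
  the span of the remaining differences is smaller, so induction on its dimension applies.
\<close>

lemma disjoint_convex_finite_tests:
  fixes S T :: "'a::euclidean_space set"
  assumes "convex S" "convex T" "S \<inter> T = {}"
  shows "\<exists>H. finite H \<and> (\<forall>x\<in>S. \<forall>y\<in>T. \<not> same_tests H x y)"
  using assms
proof (induction "dim {y - x | x y. x \<in> S \<and> y \<in> T}" arbitrary: S T rule: less_induct)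
  case less
  show ?case
  proof (cases "S = {} \<or> T = {}")
    case True
    then show ?thesis by (intro exI[of _ "{}"]) auto
  next
    case False
    define D where "D = {y - x | x y. x \<in> S \<and> y \<in> T}"
    have "D = (\<Union>y\<in>T. \<Union>x\<in>S. {y - x})"
      by (auto simp: D_def)
    then have "convex D"
      using convex_differences[OF less.prems(2,1)] by simp
    moreover have "D \<noteq> {}" "0 \<notin> D"
      using False less.prems(3) by (auto simp: D_def)
    ultimately obtain a where a: "a \<in> span D" "a \<noteq> 0" "\<And>d. d \<in> D \<Longrightarrow> 0 \<le> a \<bullet> d"
      using separating_hyperplane_set_0_inspan by blast
    have le: "a \<bullet> x \<le> a \<bullet> y" if "x \<in> S" "y \<in> T" for x y
      using a(3)[of "y - x"] that by (auto simp: D_def inner_diff_right)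
    \<comment> \<open>Any value between the supremum over \<open>S\<close> and the infimum over \<open>T\<close> would do as threshold.\<close>
    define b where "b = (SUP x\<in>S. a \<bullet> x)"
    obtain y0 where "y0 \<in> T" using False by auto
    then have bdd: "bdd_above ((\<lambda>x. a \<bullet> x) ` S)"
      using le by (intro bdd_aboveI2[of _ _ "a \<bullet> y0"]) auto
    have Sb: "a \<bullet> x \<le> b" if "x \<in> S" for x
      unfolding b_def using bdd that by (rule cSUP_upper2) auto
    have Tb: "b \<le> a \<bullet> y" if "y \<in> T" for y
      unfolding b_def using False le that by (intro cSUP_least) auto
    \<comment> \<open>The parts that the two tests on \<open>a\<close> cannot tell apart.\<close>
    define S' where "S' = S \<inter> {x. a \<bullet> x = b}"
    define T' where "T' = T \<inter> {x. a \<bullet> x = b}"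
    define D' where "D' = {y - x | x y. x \<in> S' \<and> y \<in> T'}"
    have "D' \<subseteq> D" by (auto simp: D_def D'_def S'_def T'_def)
    have "D' \<subseteq> {d. a \<bullet> d = 0}"
      by (auto simp: D'_def S'_def T'_def inner_diff_right)
    then have "span D' \<subseteq> {d. a \<bullet> d = 0}"
      by (rule span_minimal) (rule subspace_hyperplane)
    then have "a \<notin> span D'" using a(2) by auto
    then have "span D' \<subset> span D"
      using a(1) span_mono[OF \<open>D' \<subseteq> D\<close>] by auto
    then have "dim D' < dim D" by (rule dim_psubset)
    then obtain H where H: "finite H" "\<forall>x\<in>S'. \<forall>y\<in>T'. \<not> same_tests H x y"
      using less.hyps[of S' T'] less.prems unfolding D_def D'_def
      by (auto simp: S'_def T'_def convex_Int convex_hyperplane)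
    have "\<not> same_tests (insert (a, b) (insert (- a, - b) H)) x y" if xy: "x \<in> S" "y \<in> T" for x y
    proof
      assume *: "same_tests (insert (a, b) (insert (- a, - b) H)) x y"
      then have "a \<bullet> y \<le> b" "b \<le> a \<bullet> x"
        using Sb[OF xy(1)] Tb[OF xy(2)] by (auto simp: same_tests_def)
      then have "x \<in> S'" "y \<in> T'"
        using Sb[OF xy(1)] Tb[OF xy(2)] xy by (auto simp: S'_def T'_def)
      then show False using H(2) same_tests_mono[OF *, of H] by auto
    qed
    then show ?thesis using H(1) by (intro exI[of _ "insert (a, b) (insert (- a, - b) H)"]) auto
  qed
qed

section \<open>Single-valued affine relations\<close>

text \<open>
  Translate \<open>L\<close> to a subspace. There the projection to the first component is injective, hence has
  a linear left inverse on the whole space, whose second component is the linear part.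
\<close>

lemma affine_single_valued_imp_affine_map:
  fixes L :: "('x::real_vector \<times> 'z::real_vector) set"
  assumes "affine L" and single: "\<And>x z z'. (x, z) \<in> L \<Longrightarrow> (x, z') \<in> L \<Longrightarrow> z = z'"
  shows "\<exists>l c. linear l \<and> (\<forall>(x, z)\<in>L. z = l x + c)"
proof (cases "L = {}")
  case True
  then show ?thesis by (auto intro: exI[of _ "\<lambda>_. 0"] linear_zero)
next
  case False
  then obtain x0 z0 where p0: "(x0, z0) \<in> L" by auto
  define V where "V = (\<lambda>p. p - (x0, z0)) ` L"
  have V: "subspace V"
    unfolding V_def using affine_diffs_subspace_subtract[OF assms(1) p0] .
  have inj: "inj_on fst V"
  proof (rule inj_onI)
    fix v w assume "v \<in> V" "w \<in> V" "fst v = fst w"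
    then show "v = w" using single by (force simp: V_def)
  qed
  have "linear (fst :: 'x \<times> 'z \<Rightarrow> 'x)"
    by (rule linear_fst)
  then obtain g :: "'x \<Rightarrow> 'x \<times> 'z" where g: "linear g" "\<forall>v\<in>V. g (fst v) = v"
    using real_vector.linear_exists_left_inverse_on[OF _ V inj] by blast
  have "linear (\<lambda>x. snd (g x))"
    using linear_compose[OF g(1) linear_snd] by (simp add: o_def)
  moreover have "z = snd (g x) + (z0 - snd (g x0))" if "(x, z) \<in> L" for x z
  proof -
    have "(x, z) - (x0, z0) \<in> V" unfolding V_def using that by (rule imageI)
    then have "g (x - x0) = (x - x0, z - z0)" using g(2) by force
    moreover have "g (x - x0) = g x - g x0" by (rule linear_diff[OF g(1)])
    ultimately have "snd (g x) - snd (g x0) = z - z0" by (metis snd_diff snd_conv)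
    then show ?thesis by (simp add: algebra_simps)
  qed
  ultimately show ?thesis by blast
qed

section \<open>Parametric strictly convex quadratic programs\<close>

text \<open>
  A point is a pair \<open>(x, z)\<close> of a parameter and a decision, with \<open>z\<close> confined to the affine space
  \<open>e + D\<close>. The cost is \<open>\<beta> p p\<close>, and a constraint is a pair \<open>(g, h)\<close> that stands for \<open>g p \<le> h\<close>.
  Definiteness on \<open>D\<close> is strict convexity in the decision. The decision space is
  an arbitrary vector space, so that input sequences can be used as they are.
\<close>

locale parametric_qp =
  fixes \<beta> :: "'x::euclidean_space \<times> 'z::real_vector \<Rightarrow> 'x \<times> 'z \<Rightarrow> real"
    and D :: "'z set" and e :: 'z
    and C :: "(('x \<times> 'z \<Rightarrow> real) \<times> real) set"
  assumes bilinear: "bilinear \<beta>"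
    and commute: "\<beta> p q = \<beta> q p"
    and pos: "d \<in> D \<Longrightarrow> d \<noteq> 0 \<Longrightarrow> 0 < \<beta> (0, d) (0, d)"
    and subspace: "subspace D"
    and finite_constraints: "finite C"
    and linear_constraint: "(g, h) \<in> C \<Longrightarrow> linear g"
begin

definition feasible :: "'x \<times> 'z \<Rightarrow> bool" where
  "feasible p \<longleftrightarrow> snd p - e \<in> D \<and> (\<forall>(g, h)\<in>C. g p \<le> h)"

definition optimal :: "'x \<times> 'z \<Rightarrow> bool" where
  "optimal p \<longleftrightarrow> feasible p \<and> (\<forall>q. feasible q \<and> fst q = fst p \<longrightarrow> \<beta> p p \<le> \<beta> q q)"

definition active :: "'x \<times> 'z \<Rightarrow> (('x \<times> 'z \<Rightarrow> real) \<times> real) set" where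
  "active p = {(g, h)\<in>C. g p = h}"

text \<open>
  The first-order condition at \<open>p\<close>, relative to an arbitrary set \<open>A\<close> of constraints in place of the
  active ones: for fixed \<open>A\<close> it is linear in \<open>p\<close>.
\<close>

definition stationary :: "(('x \<times> 'z \<Rightarrow> real) \<times> real) set \<Rightarrow> 'x \<times> 'z \<Rightarrow> bool" where
  "stationary A p \<longleftrightarrow> (\<forall>d\<in>D. (\<forall>(g, h)\<in>A. g (0, d) \<le> 0) \<longrightarrow> 0 \<le> \<beta> p (0, d))"

lemmas \<beta>_simps = bilinear_ladd[OF bilinear] bilinear_radd[OF bilinear]
  bilinear_lmul[OF bilinear] bilinear_rmul[OF bilinear]

lemma cost_along: "\<beta> (p + s *\<^sub>R v) (p + s *\<^sub>R v) = \<beta> p p + s * (2 * \<beta> p v + s * \<beta> v v)"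
  using commute[of v p] by (simp add: \<beta>_simps algebra_simps)

text \<open>
  A short step along an admissible direction stays feasible, since the inactive constraints have
  room to spare. Dividing the cost change by the step length and letting it tend to zero gives the
  sign.
\<close>

lemma optimal_imp_stationary:
  assumes "optimal p"
  shows "stationary (active p) p"
  unfolding stationary_def
proof (intro ballI impI)
  fix d assume d: "d \<in> D" and dir: "\<forall>(g, h)\<in>active p. g (0, d) \<le> 0"
  define v :: "'x \<times> 'z" where "v = (0, d)"
  have feas: "snd p - e \<in> D" "\<And>g h. (g, h) \<in> C \<Longrightarrow> g p \<le> h"
    using assms by (auto simp: optimal_def feasible_def)
  have "\<forall>c\<in>C. \<forall>\<^sub>F s in at_right (0::real). fst c (p + s *\<^sub>R v) \<le> snd c"
  proof
    fix c assume "c \<in> C"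
    obtain g h where c: "c = (g, h)" by force
    then have gh: "(g, h) \<in> C" using \<open>c \<in> C\<close> by simp
    have g: "g (p + s *\<^sub>R v) = g p + s * g v" for s
      using linear_constraint[OF gh] by (simp add: linear_add linear_scale)
    show "\<forall>\<^sub>F s in at_right 0. fst c (p + s *\<^sub>R v) \<le> snd c"
    proof (cases "g p = h")
      case True
      then have "g v \<le> 0" using dir gh by (auto simp: active_def v_def)
      then show ?thesis
        using True unfolding c g fst_conv snd_conv
        by (intro eventually_mono[OF eventually_at_right_less[of 0]]) (simp add: mult_nonneg_nonpos)
    next
      case False
      then have "g p < h" using feas(2)[OF gh] by simp
      moreover have "((\<lambda>s. g p + s * g v) \<longlongrightarrow> g p + 0 * g v) (at_right 0)"
        by (intro tendsto_intros)
      ultimately have "\<forall>\<^sub>F s in at_right 0. g p + s * g v < h"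
        by (auto dest: order_tendstoD(2))
      then show ?thesis
        unfolding c g fst_conv snd_conv by (rule eventually_mono) simp
    qed
  qed
  then have ev: "\<forall>\<^sub>F s in at_right (0::real). \<forall>c\<in>C. fst c (p + s *\<^sub>R v) \<le> snd c"
    using finite_constraints by (simp add: eventually_ball_finite)
  have "\<forall>\<^sub>F s in at_right (0::real). 0 \<le> 2 * \<beta> p v + s * \<beta> v v"
    using ev eventually_at_right_less[of 0]
  proof eventually_elim
    case (elim s)
    have "(snd p - e) + s *\<^sub>R d \<in> D"
      using feas(1) d subspace by (simp add: subspace_add subspace_scale)
    then have "snd (p + s *\<^sub>R v) - e \<in> D"
      by (simp add: v_def algebra_simps)
    then have "feasible (p + s *\<^sub>R v)"
      using elim(1) by (auto simp: feasible_def)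
    moreover have "fst (p + s *\<^sub>R v) = fst p" by (simp add: v_def)
    ultimately have "\<beta> p p \<le> \<beta> (p + s *\<^sub>R v) (p + s *\<^sub>R v)"
      using assms unfolding optimal_def by metis
    then show ?case
      using elim(2) by (simp add: cost_along zero_le_mult_iff)
  qed
  moreover have "((\<lambda>s. 2 * \<beta> p v + s * \<beta> v v) \<longlongrightarrow> 2 * \<beta> p v + 0 * \<beta> v v) (at_right 0)"
    by (intro tendsto_intros)
  ultimately have "0 \<le> 2 * \<beta> p v + 0 * \<beta> v v"
    by (intro tendsto_lowerbound) auto
  then show "0 \<le> \<beta> p (0, d)" by (simp add: v_def)
qed

lemma feasible_difference:
  assumes "feasible p" "feasible q" "fst q = fst p"
  obtains d where "d \<in> D" "q - p = (0, d)"
proof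
  have "(snd q - e) - (snd p - e) \<in> D"
    by (rule subspace_diff[OF subspace]) (use assms(1,2) in \<open>simp_all add: feasible_def\<close>)
  then show "snd q - snd p \<in> D" by simp
  show "q - p = (0, snd q - snd p)" using assms(3) by (simp add: prod_eq_iff)
qed

text \<open>
  The direction from \<open>p\<close> to another feasible point is admissible for the constraints active at
  \<open>p\<close>, so the first-order term of the cost along it is nonnegative. What remains of the growth is
  the quadratic term, which gives both optimality and uniqueness.
\<close>

lemma stationary_growth:
  assumes "stationary (active p) p" "feasible p" "feasible q" "fst q = fst p"
  shows "\<beta> p p + \<beta> (q - p) (q - p) \<le> \<beta> q q"
proof -
  obtain d where d: "d \<in> D" "q - p = (0, d)"
    using feasible_difference assms(2-4) by blast
  have "g (0, d) \<le> 0" if "(g, h) \<in> active p" for g h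
  proof -
    have "g (0, d) = g q - g p"
      using that linear_constraint by (auto simp: active_def linear_diff simp flip: d(2))
    then show ?thesis using that assms(3) by (auto simp: active_def feasible_def)
  qed
  then have "0 \<le> \<beta> p (q - p)"
    using assms(1) d by (auto simp: stationary_def)
  then show ?thesis
    using cost_along[of p 1 "q - p"] by simp
qed

lemma stationary_strict_growth:
  assumes "stationary (active p) p" "feasible p" "feasible q" "fst q = fst p" "q \<noteq> p"
  shows "\<beta> p p < \<beta> q q"
proof -
  obtain d where d: "d \<in> D" "q - p = (0, d)"
    using feasible_difference assms(2-4) by blast
  have "d \<noteq> 0" using d(2) assms(5) by (auto simp flip: zero_prod_def)
  then have "0 < \<beta> (q - p) (q - p)" using pos[OF d(1)] d(2) by simp
  then show ?thesis using stationary_growth[OF assms(1-4)] by simp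
qed

lemma stationary_imp_optimal:
  assumes "stationary (active p) p" "feasible p"
  shows "optimal p"
  using assms stationary_strict_growth[OF assms] unfolding optimal_def
  by (metis less_eq_real_def)

lemma optimal_unique:
  assumes "optimal p" "optimal q" "fst q = fst p"
  shows "q = p"
proof (rule ccontr)
  assume "q \<noteq> p"
  then have "\<beta> p p < \<beta> q q"
    using assms by (intro stationary_strict_growth optimal_imp_stationary) (auto simp: optimal_def)
  moreover have "\<beta> q q \<le> \<beta> p p"
    using assms unfolding optimal_def by metis
  ultimately show False by simp
qed

definition optimal_graph :: "(('x \<times> 'z \<Rightarrow> real) \<times> real) set \<Rightarrow> ('x \<times> 'z) set" where
  "optimal_graph A = {p. optimal p \<and> active p = A}"

text \<open>
  For a fixed active set all defining conditions of this set survive convex combinations: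
  equality on \<open>A\<close>, strict inequality on the other constraints, and stationarity relative to \<open>A\<close>,
  which then characterises the optimum.
\<close>

lemma convex_optimal_graph: "convex (optimal_graph A)"
proof (rule convexI)
  fix p q :: "'x \<times> 'z" and u v :: real
  assume p: "p \<in> optimal_graph A" and q: "q \<in> optimal_graph A"
    and uv: "0 \<le> u" "0 \<le> v" "u + v = 1"
  define r where "r = u *\<^sub>R p + v *\<^sub>R q"
  have A: "A = active p" "A = active q" "A \<subseteq> C"
    using p q by (auto simp: optimal_graph_def active_def)
  have feas: "feasible p" "feasible q"
    using p q by (auto simp: optimal_graph_def optimal_def)
  have g: "g r = u * g p + v * g q" if "(g, h) \<in> C" for g h
    using linear_constraint[OF that] by (simp add: r_def linear_add linear_scale)
  have h: "h = u * h + v * h" for h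
    using uv(3) by (metis distrib_right mult_1)
  have slack: "h - g r = u * (h - g p) + v * (h - g q)" if "(g, h) \<in> C" for g h
    using h[of h] by (simp add: g[OF that] algebra_simps)
  have nonneg: "0 \<le> h - g p" "0 \<le> h - g q" if "(g, h) \<in> C" for g h
    using feas that by (auto simp: feasible_def)
  have "snd r - e = u *\<^sub>R (snd p - e) + v *\<^sub>R (snd q - e)"
  proof -
    have "e = u *\<^sub>R e + v *\<^sub>R e" using uv(3) by (metis scaleR_left.add scaleR_one)
    then show ?thesis by (simp add: r_def algebra_simps)
  qed
  moreover have "0 \<le> h - g r" if "(g, h) \<in> C" for g h
    using slack[OF that] nonneg[OF that] uv by simp
  ultimately have "feasible r"
    using feas subspace by (auto simp: feasible_def subspace_add subspace_scale)
  moreover have "active r = A"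
  proof -
    have pq: "g p = h \<longleftrightarrow> g q = h" if "(g, h) \<in> C" for g h
    proof -
      have "(g, h) \<in> active p \<longleftrightarrow> (g, h) \<in> active q" using A by simp
      then show ?thesis using that by (simp add: active_def)
    qed
    have "g r = h \<longleftrightarrow> g p = h" if "(g, h) \<in> C" for g h
    proof
      assume "g r = h"
      then have "u * (h - g p) + v * (h - g q) = 0"
        using slack[OF that] by simp
      \<comment> \<open>One of the two weights is positive, so \<open>g\<close> is tight at \<open>p\<close> or at \<open>q\<close>, hence at both.\<close>
      then have *: "u * (h - g p) = 0" "v * (h - g q) = 0"
        using nonneg[OF that] uv by (auto simp: add_nonneg_eq_0_iff)
      then show "g p = h" using pq[OF that] uv by auto
    next
      assume "g p = h"
      then show "g r = h" using slack[OF that] pq[OF that] by simp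
    qed
    then show ?thesis unfolding A(1) active_def by auto
  qed
  moreover have "stationary A r"
  proof -
    have "stationary A p" "stationary A q"
      using p q optimal_imp_stationary[of p] optimal_imp_stationary[of q]
      by (simp_all add: optimal_graph_def)
    then show ?thesis
      using uv by (auto simp: stationary_def r_def \<beta>_simps)
  qed
  ultimately show "u *\<^sub>R p + v *\<^sub>R q \<in> optimal_graph A"
    using stationary_imp_optimal by (auto simp: optimal_graph_def simp flip: r_def)
qed

text \<open>
  Directions along which all constraints of \<open>A\<close> are constant are admissible in both senses, so the
  first-order condition is an equation there. These equations, with those for \<open>A\<close>, define the
  affine set \<open>L\<close>. Two decisions in \<open>L\<close> for the same parameter differ by such a direction, on
  which \<open>\<beta>\<close> vanishes, so they coincide by definiteness.
\<close>

lemma optimal_graph_affine_law: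
  "\<exists>l c. linear l \<and> (\<forall>(x, z)\<in>optimal_graph A. z = l x + c)"
proof (cases "A \<subseteq> C")
  case False
  then have "optimal_graph A = {}" by (auto simp: optimal_graph_def active_def)
  then show ?thesis by (auto intro: exI[of _ "\<lambda>_. 0"] linear_zero)
next
  case True
  define L where "L = {p. snd p - e \<in> D \<and> (\<forall>(g, h)\<in>A. g p = h) \<and>
    (\<forall>d\<in>D. (\<forall>(g, h)\<in>A. g (0, d) = 0) \<longrightarrow> \<beta> p (0, d) = 0)}"
  have "affine L"
    unfolding affine_def
  proof (intro ballI allI impI)
    fix p q :: "'x \<times> 'z" and u v :: real
    assume p: "p \<in> L" and q: "q \<in> L" and uv: "u + v = 1"
    have "e = u *\<^sub>R e + v *\<^sub>R e" using uv by (metis scaleR_left.add scaleR_one)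
    then have "snd (u *\<^sub>R p + v *\<^sub>R q) - e = u *\<^sub>R (snd p - e) + v *\<^sub>R (snd q - e)"
      by (simp add: algebra_simps)
    then have "snd (u *\<^sub>R p + v *\<^sub>R q) - e \<in> D"
      using p q subspace by (simp add: L_def subspace_add subspace_scale)
    moreover have "g (u *\<^sub>R p + v *\<^sub>R q) = h" if "(g, h) \<in> A" for g h
    proof -
      have "linear g" using that True linear_constraint by blast
      moreover have "g p = h" "g q = h" using p q that by (auto simp: L_def)
      ultimately have "g (u *\<^sub>R p + v *\<^sub>R q) = u * h + v * h"
        by (simp add: linear_add linear_scale)
      then show ?thesis using uv by (metis distrib_right mult_1)
    qed
    ultimately show "u *\<^sub>R p + v *\<^sub>R q \<in> L"
      using p q by (auto simp: L_def \<beta>_simps)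
  qed
  moreover have "z = z'" if "(x, z) \<in> L" "(x, z') \<in> L" for x z z'
  proof (rule ccontr)
    assume "z \<noteq> z'"
    define d where "d = z - z'"
    have "z - e \<in> D" "z' - e \<in> D" using that by (simp_all add: L_def)
    then have "(z - e) - (z' - e) \<in> D" by (rule subspace_diff[OF subspace])
    then have d: "d \<in> D" "d \<noteq> 0" using \<open>z \<noteq> z'\<close> by (simp_all add: d_def)
    have zz: "(0, d) = (x, z) - (x, z')" by (simp add: d_def)
    have "g (0, d) = 0" if "(g, h) \<in> A" for g h
    proof -
      have lin: "linear g" using that True linear_constraint by blast
      have "g (x, z) = h" "g (x, z') = h"
        using \<open>(x, z) \<in> L\<close> \<open>(x, z') \<in> L\<close> that by (auto simp: L_def)
      then show ?thesis unfolding zz linear_diff[OF lin] by simp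
    qed
    then have "\<beta> (x, z) (0, d) = 0" "\<beta> (x, z') (0, d) = 0"
      using that d by (auto simp: L_def)
    then have "\<beta> (0, d) (0, d) = 0"
      using bilinear_lsub[OF bilinear, of "(x, z)" "(x, z')" "(0, d)"] zz by simp
    then show False using pos[OF d] by simp
  qed
  ultimately obtain l c where lc: "linear l" "\<forall>(x, z)\<in>L. z = l x + c"
    using affine_single_valued_imp_affine_map[of L] by blast
  have "optimal_graph A \<subseteq> L"
  proof
    fix p assume p: "p \<in> optimal_graph A"
    then have st: "stationary A p" and act: "A = active p" and feas: "feasible p"
      using optimal_imp_stationary[of p] by (simp_all add: optimal_graph_def optimal_def)
    have "\<beta> p (0, d) = 0" if d: "d \<in> D" "\<forall>(g, h)\<in>A. g (0, d) = 0" for d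
    proof -
      have neg: "(0, - d) = - (0 :: 'x, d)" by simp
      have zero: "g (0, d) = 0 \<and> g (0, - d) = 0" if "(g, h) \<in> A" for g h
      proof -
        have lin: "linear g" using that True linear_constraint by blast
        have "g (0, d) = 0" using d(2) that by blast
        then show ?thesis unfolding neg linear_neg[OF lin] by simp
      qed
      have "0 \<le> \<beta> p (0, d')" if "d' = d \<or> d' = - d" for d'
      proof -
        have "d' \<in> D" using that d(1) subspace_neg[OF subspace d(1)] by auto
        moreover have "\<forall>(g, h)\<in>A. g (0, d') \<le> 0" using zero that by fastforce
        ultimately show ?thesis using st unfolding stationary_def by blast
      qed
      then have "0 \<le> \<beta> p (0, d)" "0 \<le> \<beta> p (0, - d)" by blast+
      moreover have "\<beta> p (0, - d) = - \<beta> p (0, d)"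
        unfolding neg by (rule bilinear_rneg[OF bilinear])
      ultimately show ?thesis by simp
    qed
    then show "p \<in> L"
      using feas act by (auto simp: L_def feasible_def active_def)
  qed
  then show ?thesis using lc by blast
qed

text \<open>
  Optima with different active sets belong to different parameters, so the projections of the
  graphs to the parameter space are disjoint convex sets, and tests that separate them pairwise
  determine the active set.
\<close>

lemma finite_tests_affine_law:
  "\<exists>H. finite H \<and> (\<forall>p. optimal p \<longrightarrow>
     (\<exists>l c. linear l \<and> (\<forall>q. optimal q \<and> same_tests H (fst p) (fst q) \<longrightarrow> snd q = l (fst q) + c)))"
proof -
  let ?R = "\<lambda>A. fst ` optimal_graph A"
  have "\<exists>H. finite H \<and> (\<forall>x\<in>?R A. \<forall>y\<in>?R B. \<not> same_tests H x y)" if "A \<noteq> B" for A B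
  proof (rule disjoint_convex_finite_tests)
    show "convex (?R A)" "convex (?R B)"
      by (intro convex_linear_image linear_fst convex_optimal_graph)+
    show "?R A \<inter> ?R B = {}"
    proof (rule equals0I)
      fix x assume "x \<in> ?R A \<inter> ?R B"
      then obtain p q where "p \<in> optimal_graph A" "x = fst p" "q \<in> optimal_graph B" "x = fst q"
        by blast
      then show False
        using optimal_unique[of p q] that by (simp add: optimal_graph_def)
    qed
  qed
  then obtain H where H: "\<And>A B. A \<noteq> B \<Longrightarrow> finite (H A B)"
    "\<And>A B x y. A \<noteq> B \<Longrightarrow> x \<in> ?R A \<Longrightarrow> y \<in> ?R B \<Longrightarrow> \<not> same_tests (H A B) x y"
    by metis
  define G where "G = (\<Union>(A, B)\<in>{(A, B). A \<subseteq> C \<and> B \<subseteq> C \<and> A \<noteq> B}. H A B)"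
  have "finite {(A, B). A \<subseteq> C \<and> B \<subseteq> C \<and> A \<noteq> B}"
    by (rule finite_subset[of _ "Pow C \<times> Pow C"]) (use finite_constraints in auto)
  then have "finite G" using H(1) by (auto simp: G_def)
  moreover have "\<exists>l c. linear l \<and>
      (\<forall>q. optimal q \<and> same_tests G (fst p) (fst q) \<longrightarrow> snd q = l (fst q) + c)" if p: "optimal p" for p
  proof -
    obtain l c where lc: "linear l" "\<forall>(x, z)\<in>optimal_graph (active p). z = l x + c"
      using optimal_graph_affine_law by blast
    have "active q = active p" if q: "optimal q" "same_tests G (fst p) (fst q)" for q
    proof (rule ccontr)
      assume ne: "active q \<noteq> active p"
      have "active q \<subseteq> C" "active p \<subseteq> C" by (auto simp: active_def)
      then have "H (active p) (active q) \<subseteq> G"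
        unfolding G_def using ne by (intro UN_upper[of "(active p, active q)", THEN order_trans[rotated]]) auto
      then have "same_tests (H (active p) (active q)) (fst p) (fst q)"
        using q(2) same_tests_mono by blast
      then show False
        using H(2)[of "active p" "active q" "fst p" "fst q"] ne p q(1)
        by (simp add: optimal_graph_def)
    qed
    then have "q \<in> optimal_graph (active p)" if "optimal q" "same_tests G (fst p) (fst q)" for q
      using that by (simp add: optimal_graph_def)
    then show ?thesis
      using lc by (intro exI[of _ l] exI[of _ c]) (simp add: case_prod_beta)
  qed
  ultimately show ?thesis by blast
qed

end

section \<open>Finitely many tests as an oblique decision tree\<close>

lemma odt_branch_nodes_iff: "t \<in> odt_branch_nodes D \<longleftrightarrow> 1 \<le> t \<and> t < 2 ^ D"
  by (auto simp: odt_branch_nodes_def odt_size_def)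

lemma inner_level_in_branch_nodes:
  assumes "k < D" "2 ^ k \<le> t" "t < 2 ^ (k + 1)"
  shows "t \<in> odt_branch_nodes D"
proof -
  have "(1::nat) \<le> 2 ^ k" "(2::nat) ^ (k + 1) \<le> 2 ^ D"
    using assms(1) by (auto intro!: power_increasing simp del: power_Suc)
  then show ?thesis using assms unfolding odt_branch_nodes_iff by linarith
qed

text \<open>
  Halving a node number gives the parent, so a leaf reached from \<open>t\<close> in \<open>k\<close> steps determines \<open>t\<close>.
\<close>

lemma odt_descend_div:
  assumes "k \<le> D" "2 ^ (D - k) \<le> t" "t < 2 ^ (D - k + 1)"
  shows "odt_descend D a b x t div 2 ^ k = t"
  using assms
proof (induction k arbitrary: t)
  case 0
  then show ?case by (subst odt_descend.simps) (simp add: odt_branch_nodes_iff)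
next
  case (Suc k)
  then have "D - k = Suc (D - Suc k)" by simp
  define c where "c = (if a t \<bullet> x \<le> b t then 2 * t else 2 * t + 1)"
  have "t \<in> odt_branch_nodes D"
    using Suc.prems by (intro inner_level_in_branch_nodes[of "D - Suc k"]) auto
  then have "odt_descend D a b x t = odt_descend D a b x c"
    by (subst odt_descend.simps) (simp add: c_def)
  moreover have "odt_descend D a b x c div 2 ^ k = c"
    using Suc.prems unfolding \<open>D - k = Suc (D - Suc k)\<close> c_def
    by (intro Suc.IH) (auto simp: \<open>D - k = Suc (D - Suc k)\<close>)
  moreover have "c div 2 = t" by (simp add: c_def)
  ultimately show ?case by (metis div_mult2_eq power_Suc2)
qed

text \<open>
  The nodes on level \<open>i\<close> are those with binary logarithm \<open>i\<close>, and all of them carry the test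
  \<open>ts ! i\<close>. Equal leaves have equal ancestors, so two inputs that reach the same leaf take the
  same branch at every level.
\<close>

lemma odt_descend_eq_imp_same_tests:
  assumes leaf: "odt_descend D a b x t = odt_descend D a b y t"
    and "k \<le> D" "2 ^ (D - k) \<le> t" "t < 2 ^ (D - k + 1)"
    and a: "\<And>s. a s = fst (ts ! floor_log s)" and b: "\<And>s. b s = snd (ts ! floor_log s)"
    and "D - k \<le> i" "i < D"
  shows "fst (ts ! i) \<bullet> x \<le> snd (ts ! i) \<longleftrightarrow> fst (ts ! i) \<bullet> y \<le> snd (ts ! i)"
  using leaf assms(2-4,7,8)
proof (induction k arbitrary: t)
  case 0
  then show ?case by simp
next
  case (Suc k)
  then have Dk: "D - k = Suc (D - Suc k)" by simp
  define c where "c x = (if a t \<bullet> x \<le> b t then 2 * t else 2 * t + 1)" for x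
  have "t \<in> odt_branch_nodes D"
    using Suc.prems by (intro inner_level_in_branch_nodes[of "D - Suc k"]) auto
  then have step: "odt_descend D a b z t = odt_descend D a b z (c z)" for z
    by (subst odt_descend.simps) (simp add: c_def)
  have range: "2 ^ (D - k) \<le> c z" "c z < 2 ^ (D - k + 1)" for z
    using Suc.prems by (auto simp: c_def Dk)
  have "c z = odt_descend D a b z t div 2 ^ k" for z
    unfolding step by (rule odt_descend_div[symmetric]) (use Suc.prems range in auto)
  then have cc: "c x = c y" using Suc.prems(1) by simp
  show ?case
  proof (cases "i = D - Suc k")
    case True
    have "floor_log t = i"
      using Suc.prems True by (intro floor_log_eqI) auto
    then show ?thesis using cc a b by (auto simp: c_def split: if_splits)
  next
    case False
    then show ?thesis
      using Suc.prems range[of x] cc step[of x] step[of y] by (intro Suc.IH[of "c x"]) auto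
  qed
qed

text \<open>
  The inputs in \<open>X\<close> that reach a given leaf agree on all tests, so the affine law at one of them
  is valid for all and supplies the prediction at the leaf. Leaves that no input in \<open>X\<close> reaches
  may carry anything.
\<close>

lemma odt_of_finite_tests:
  fixes f :: "real^'n \<Rightarrow> real^'m"
  assumes "finite H"
    and law: "\<And>x. x \<in> X \<Longrightarrow>
      \<exists>l c. linear l \<and> (\<forall>y\<in>X. same_tests H x y \<longrightarrow> f y = l y + c)"
  shows "\<exists>D a b (c :: nat \<Rightarrow> real^'m^'n) d. \<forall>x\<in>X. odt_output D a b c d x = f x"
proof -
  obtain ts where ts: "set ts = H" using finite_list[OF assms(1)] by blast
  define D where "D = length ts"
  define a where "a s = fst (ts ! floor_log s)" for s
  define b where "b s = snd (ts ! floor_log s)" for s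
  define leaf where "leaf x = odt_descend D a b x 1" for x
  have tests: "same_tests H x y" if "leaf x = leaf y" for x y
  proof -
    have "fst (ts ! i) \<bullet> x \<le> snd (ts ! i) \<longleftrightarrow> fst (ts ! i) \<bullet> y \<le> snd (ts ! i)" if "i < D" for i
      using odt_descend_eq_imp_same_tests[of D a b x 1 y D ts i] \<open>leaf x = leaf y\<close> that
      by (simp add: leaf_def a_def b_def)
    then show ?thesis
      unfolding same_tests_def ts[symmetric] D_def by (fastforce simp: in_set_conv_nth)
  qed
  have "\<exists>M v. \<forall>x\<in>X. leaf x = t \<longrightarrow> f x = transpose (M :: real^'m^'n) *v x + v" for t
  proof (cases "\<exists>x\<in>X. leaf x = t")
    case True
    then obtain x where x: "x \<in> X" "leaf x = t" by blast
    then obtain l c where lc: "linear l" "\<forall>y\<in>X. same_tests H x y \<longrightarrow> f y = l y + c"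
      using law by blast
    have "\<forall>y\<in>X. leaf y = t \<longrightarrow> f y = transpose (transpose (matrix l)) *v y + c"
      using lc tests x by (auto simp: matrix_works)
    then show ?thesis by blast
  qed auto
  then obtain c d where "\<And>t. \<forall>x\<in>X. leaf x = t \<longrightarrow> f x = transpose (c t :: real^'m^'n) *v x + d t"
    by metis
  then have "\<forall>x\<in>X. odt_output D a b c d x = f x"
    by (auto simp: odt_output_def leaf_def Let_def)
  then show ?thesis by blast
qed

section \<open>The vector space of input sequences\<close>

text \<open>
  Pointwise scaling makes \<open>nat \<Rightarrow> real^'m\<close> a vector space, and with it the pairs of an initial state
  and an input sequence. The horizon is a variable, so it cannot serve as the index type of a
  Euclidean space of input sequences.
\<close>

instantiation "fun" :: (type, real_vector) real_vector
begin

definition "c *\<^sub>R f = (\<lambda>x. c *\<^sub>R f x)"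

instance
  by standard (auto simp: scaleR_fun_def fun_eq_iff algebra_simps)

end

lemma scaleR_fun_apply [simp]: "(c *\<^sub>R f) x = c *\<^sub>R f x"
  by (simp add: scaleR_fun_def)

section \<open>Model predictive control as a parametric quadratic program\<close>

lemma mpc_state_add:
  "mpc_state A B (x + y) (u + v) k = mpc_state A B x u k + mpc_state A B y v k"
  by (induction k) (simp_all add: matrix_vector_right_distrib)

lemma mpc_state_scaleR: "mpc_state A B (c *\<^sub>R x) (c *\<^sub>R u) k = c *\<^sub>R mpc_state A B x u k"
  by (induction k) (simp_all add: matrix_vector_mult_scaleR scaleR_add_right)

lemma linear_mpc_state: "linear (\<lambda>p. mpc_state A B (fst p) (snd p) k)"
  by (rule linearI) (simp_all only: fst_add snd_add fst_scaleR snd_scaleR mpc_state_add mpc_state_scaleR)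

text \<open>The symmetric bilinear form that polarises the cost.\<close>

definition mpc_form ::
  "real^'n^'n \<Rightarrow> real^'m^'n \<Rightarrow> real^'n^'n \<Rightarrow> real^'m^'m \<Rightarrow> real^'n^'n \<Rightarrow> nat \<Rightarrow>
   (real^'n) \<times> (nat \<Rightarrow> real^'m) \<Rightarrow> (real^'n) \<times> (nat \<Rightarrow> real^'m) \<Rightarrow> real" where
  "mpc_form A B Q R P N p q =
     (\<Sum>k<N. mpc_state A B (fst p) (snd p) k \<bullet> (Q *v mpc_state A B (fst q) (snd q) k)
        + snd p k \<bullet> (R *v snd q k))
     + mpc_state A B (fst p) (snd p) N \<bullet> (P *v mpc_state A B (fst q) (snd q) N)"

lemma mpc_cost_eq_form: "mpc_cost A B Q R P N x u = mpc_form A B Q R P N (x, u) (x, u)"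
  by (simp add: mpc_cost_def mpc_form_def)

lemma bilinear_mpc_form: "bilinear (mpc_form A B Q R P N)"
proof -
  note simps = mpc_form_def mpc_state_add mpc_state_scaleR inner_add_left inner_add_right
    matrix_vector_right_distrib matrix_vector_mult_scaleR sum.distrib sum_distrib_left distrib_left
  show ?thesis
    unfolding bilinear_def by (intro conjI allI linearI) (simp_all add: simps)
qed

lemma inner_symmetric_matrix:
  fixes M :: "real^'n^'n"
  assumes "transpose M = M"
  shows "x \<bullet> (M *v y) = y \<bullet> (M *v x)"
  using assms by (metis dot_lmul_matrix inner_commute vector_transpose_matrix)

lemma mpc_form_commute:
  assumes "pos_semidef Q" "pos_semidef P" "pos_def R"
  shows "mpc_form A B Q R P N p q = mpc_form A B Q R P N q p"
proof -
  have "transpose Q = Q" "transpose P = P" "transpose R = R"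
    using assms by (auto simp: pos_semidef_def pos_def_def)
  then show ?thesis
    unfolding mpc_form_def
    by (intro arg_cong2[of _ _ _ _ "(+)"] sum.cong refl inner_symmetric_matrix)
qed

lemma mpc_form_pos:
  assumes "pos_semidef Q" "pos_semidef P" "pos_def R" and "k < N" "u k \<noteq> 0"
  shows "0 < mpc_form A B Q R P N (x, u) (x, u)"
proof -
  have Q: "0 \<le> y \<bullet> (Q *v y)" and P: "0 \<le> y \<bullet> (P *v y)" for y
    using assms(1,2) by (auto simp: pos_semidef_def)
  have R: "y \<noteq> 0 \<Longrightarrow> 0 < y \<bullet> (R *v y)" for y
    using assms(3) by (auto simp: pos_def_def)
  have R': "0 \<le> y \<bullet> (R *v y)" for y
    using R[of y] by (cases "y = 0") auto
  have "0 < (\<Sum>k<N. mpc_state A B x u k \<bullet> (Q *v mpc_state A B x u k) + u k \<bullet> (R *v u k))"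
    by (rule sum_pos2[of _ k]) (use assms(4,5) Q R R' in \<open>auto intro: add_nonneg_pos add_nonneg_nonneg\<close>)
  then show ?thesis
    using P by (simp add: mpc_form_def add_pos_nonneg)
qed

definition mpc_constraints ::
  "real^'n^'n \<Rightarrow> real^'m^'n \<Rightarrow> nat \<Rightarrow> real^'n \<Rightarrow> real^'n \<Rightarrow> real^'m \<Rightarrow> real^'m \<Rightarrow>
   (((real^'n) \<times> (nat \<Rightarrow> real^'m) \<Rightarrow> real) \<times> real) set" where
  "mpc_constraints A B N xmin xmax umin umax =
     (\<Union>k\<in>{..N}. \<Union>i. {(\<lambda>p. mpc_state A B (fst p) (snd p) k $ i, xmax $ i),
                        (\<lambda>p. - mpc_state A B (fst p) (snd p) k $ i, - xmin $ i)}) \<union>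
     (\<Union>k\<in>{..<N}. \<Union>i. {(\<lambda>p. snd p k $ i, umax $ i), (\<lambda>p. - snd p k $ i, - umin $ i)})"

lemma finite_mpc_constraints: "finite (mpc_constraints A B N xmin xmax umin umax)"
  by (simp add: mpc_constraints_def)

lemma linear_mpc_constraints:
  assumes "(g, h) \<in> mpc_constraints A B N xmin xmax umin umax"
  shows "linear g"
proof -
  have "linear (\<lambda>p. mpc_state A B (fst p) (snd p) k $ i)"
    "linear (\<lambda>p. - mpc_state A B (fst p) (snd p) k $ i)" for k i
    by (rule linearI; simp add: mpc_state_add mpc_state_scaleR)+
  moreover have "linear (\<lambda>p :: (real^'n) \<times> (nat \<Rightarrow> real^'m). snd p k $ i)"
    "linear (\<lambda>p :: (real^'n) \<times> (nat \<Rightarrow> real^'m). - snd p k $ i)" for k i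
    by (rule linearI; simp)+
  ultimately show ?thesis
    using assms unfolding mpc_constraints_def by blast
qed

text \<open>
  The default value \<open>undefined\<close> beyond the horizon confines feasible sequences to an affine space:
  they lie in \<open>e + D\<close> for the constant sequence \<open>e = (\<lambda>_. undefined)\<close> and the space \<open>D\<close> of
  sequences that vanish from index \<open>N\<close> on.
\<close>

lemma mpc_feasible_inputs_iff:
  "u \<in> mpc_feasible_inputs A B N xmin xmax umin umax x \<longleftrightarrow>
     (\<forall>k\<ge>N. u k = undefined) \<and> (\<forall>(g, h)\<in>mpc_constraints A B N xmin xmax umin umax. g (x, u) \<le> h)"
proof -
  have ext: "u \<in> {..<N} \<rightarrow>\<^sub>E UNIV \<longleftrightarrow> (\<forall>k\<ge>N. u k = undefined)"
    by (simp add: PiE_iff extensional_def not_less)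
  have bounds: "(\<forall>(g, h)\<in>mpc_constraints A B N xmin xmax umin umax. g (x, u) \<le> h) \<longleftrightarrow>
      (\<forall>k\<le>N. \<forall>i. mpc_state A B x u k $ i \<le> xmax $ i \<and> xmin $ i \<le> mpc_state A B x u k $ i) \<and>
      (\<forall>k<N. \<forall>i. u k $ i \<le> umax $ i \<and> umin $ i \<le> u k $ i)"
    by (simp add: mpc_constraints_def ball_Un) (simp add: Ball_def)
  show ?thesis
    unfolding mpc_feasible_inputs_def mem_Collect_eq ext bounds less_eq_vec_def by meson
qed

lemma continuous_on_mpc_state: "continuous_on UNIV (\<lambda>u. mpc_state A B x u k)"
proof (induction k)
  case (Suc k)
  then show ?case
    by (auto intro!: continuous_on_add bounded_linear.continuous_on[OF matrix_vector_mul_bounded_linear]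
        continuous_on_product_coordinates)
qed simp

lemma continuous_on_mpc_cost: "continuous_on UNIV (mpc_cost A B Q R P N x)"
  unfolding mpc_cost_def
  by (intro continuous_on_add continuous_on_sum continuous_on_inner continuous_on_mpc_state
      bounded_linear.continuous_on[OF matrix_vector_mul_bounded_linear]
      continuous_on_product_coordinates)

text \<open>
  In the product topology on sequences the box of admissible inputs, with a single point in every
  coordinate beyond the horizon, is compact by Tychonoff's theorem. The state constraints cut out a
  closed part of it.
\<close>

lemma compact_mpc_feasible_inputs: "compact (mpc_feasible_inputs A B N xmin xmax umin umax x)"
proof -
  define K where "K = PiE UNIV (\<lambda>k. if k < N then cbox umin umax else {undefined})"
  have "compactin (product_topology (\<lambda>_. euclidean) UNIV) K"
    unfolding K_def compactin_PiE by (auto simp: compact_cbox)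
  then have "compact K"
    by (simp add: euclidean_product_topology)
  moreover have "closed (\<Inter>k\<in>{..N}. (\<lambda>u. mpc_state A B x u k) -` cbox xmin xmax)"
    by (intro closed_INT ballI closed_vimage closed_cbox continuous_on_mpc_state)
  moreover have "mpc_feasible_inputs A B N xmin xmax umin umax x =
      K \<inter> (\<Inter>k\<in>{..N}. (\<lambda>u. mpc_state A B x u k) -` cbox xmin xmax)"
    unfolding mpc_feasible_inputs_def K_def
    by (auto simp: PiE_iff extensional_def simp flip: interval_cbox split: if_splits)
  ultimately show ?thesis by (simp add: compact_Int_closed)
qed

lemma mpc_optimal_exists:
  assumes "mpc_feasible A B N xmin xmax umin umax x"
  shows "\<exists>u. mpc_optimal A B Q R P N xmin xmax umin umax x u"
proof -
  obtain u where "u \<in> mpc_feasible_inputs A B N xmin xmax umin umax x"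
    "\<forall>v\<in>mpc_feasible_inputs A B N xmin xmax umin umax x. mpc_cost A B Q R P N x u \<le> mpc_cost A B Q R P N x v"
    using continuous_attains_inf[OF compact_mpc_feasible_inputs _
        continuous_on_subset[OF continuous_on_mpc_cost subset_UNIV]] assms
    unfolding mpc_feasible_def by blast
  then show ?thesis
    by (auto simp: mpc_optimal_def is_arg_min_def not_less)
qed

theorem theorem1:
  fixes A Q P :: "real^'n^'n" and B :: "real^'m^'n" and R :: "real^'m^'m"
    and N :: nat and xmin xmax :: "real^'n" and umin umax :: "real^'m"
  assumes "stabilizable A B"
    and "N \<ge> 1"
    and "pos_semidef Q"
    and "pos_semidef P"
    and "pos_def R"
  shows "\<exists>(D :: nat) (a :: nat \<Rightarrow> real^'n) (b :: nat \<Rightarrow> real)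
           (c :: nat \<Rightarrow> real^'m^'n) (d :: nat \<Rightarrow> real^'m).
         \<forall>x0. mpc_feasible A B N xmin xmax umin umax x0 \<longrightarrow>
           odt_output D a b c d x0 = mpc_law A B Q R P N xmin xmax umin umax x0"
proof -
  interpret parametric_qp "mpc_form A B Q R P N" "{d. \<forall>k\<ge>N. d k = 0}" "\<lambda>_. undefined"
    "mpc_constraints A B N xmin xmax umin umax"
  proof (rule parametric_qp.intro)
    show "bilinear (mpc_form A B Q R P N)" by (rule bilinear_mpc_form)
    show "mpc_form A B Q R P N p q = mpc_form A B Q R P N q p" for p q
      by (rule mpc_form_commute) (fact assms)+
    show "0 < mpc_form A B Q R P N (0, d) (0, d)" if d: "d \<in> {d. \<forall>k\<ge>N. d k = 0}" "d \<noteq> 0" for d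
    proof -
      obtain k where "d k \<noteq> 0" using d(2) by (auto simp: fun_eq_iff)
      moreover from this have "k < N" using d(1) not_less by auto
      ultimately show ?thesis using mpc_form_pos assms by blast
    qed
    show "subspace {d :: nat \<Rightarrow> real^'m. \<forall>k\<ge>N. d k = 0}" by (simp add: subspace_def)
  qed (rule finite_mpc_constraints, erule linear_mpc_constraints)
  have feasible_iff: "feasible (x, u) \<longleftrightarrow> u \<in> mpc_feasible_inputs A B N xmin xmax umin umax x" for x u
    by (simp add: feasible_def mpc_feasible_inputs_iff)
  have optimal_iff: "optimal (x, u) \<longleftrightarrow> mpc_optimal A B Q R P N xmin xmax umin umax x u" for x u
    by (auto simp: optimal_def mpc_optimal_def is_arg_min_def feasible_iff not_less mpc_cost_eq_form)
  define X where "X = {x. mpc_feasible A B N xmin xmax umin umax x}"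
  have "\<forall>x\<in>X. \<exists>u. optimal (x, u) \<and> mpc_law A B Q R P N xmin xmax umin umax x = u 0"
  proof
    fix x assume x: "x \<in> X"
    obtain u where u: "optimal (x, u)"
      using mpc_optimal_exists x unfolding X_def optimal_iff by blast
    have "(THE u. mpc_optimal A B Q R P N xmin xmax umin umax x u) = u"
    proof (rule the_equality)
      show "mpc_optimal A B Q R P N xmin xmax umin umax x u" using u by (simp only: optimal_iff)
    next
      fix v assume "mpc_optimal A B Q R P N xmin xmax umin umax x v"
      then have "optimal (x, v)" by (simp only: optimal_iff)
      then have "(x, v) = (x, u)" using u by (intro optimal_unique) simp_all
      then show "v = u" by simp
    qed
    then have "mpc_law A B Q R P N xmin xmax umin umax x = u 0"
      unfolding mpc_law_def by (rule arg_cong)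
    then show "\<exists>u. optimal (x, u) \<and> mpc_law A B Q R P N xmin xmax umin umax x = u 0"
      using u by blast
  qed
  from bchoice[OF this] obtain U where U: "\<And>x. x \<in> X \<Longrightarrow> optimal (x, U x)"
    "\<And>x. x \<in> X \<Longrightarrow> mpc_law A B Q R P N xmin xmax umin umax x = U x 0"
    by blast
  obtain H where H: "finite H" "\<And>p. optimal p \<Longrightarrow> \<exists>l c. linear l \<and>
      (\<forall>q. optimal q \<and> same_tests H (fst p) (fst q) \<longrightarrow> snd q = l (fst q) + c)"
    using finite_tests_affine_law by blast
  have "\<exists>D a b (c :: nat \<Rightarrow> real^'m^'n) d. \<forall>x\<in>X. odt_output D a b c d x =
      mpc_law A B Q R P N xmin xmax umin umax x"
  proof (rule odt_of_finite_tests[OF H(1)])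
    fix x assume "x \<in> X"
    from H(2)[OF U(1)[OF this]] obtain l c where l: "linear l"
      and lc: "\<And>q. optimal q \<Longrightarrow> same_tests H x (fst q) \<Longrightarrow> snd q = l (fst q) + c"
      unfolding fst_conv by blast
    have "linear (\<lambda>y. l y 0)"
      using l by (intro linearI) (simp_all add: linear_add linear_scale)
    moreover have "mpc_law A B Q R P N xmin xmax umin umax y = l y 0 + c 0"
      if "y \<in> X" "same_tests H x y" for y
      using lc[OF U(1)[OF that(1)]] that U(2) by simp
    ultimately show "\<exists>l c. linear l \<and> (\<forall>y\<in>X. same_tests H x y \<longrightarrow>
        mpc_law A B Q R P N xmin xmax umin umax y = l y + c)"
      by (intro exI[of _ "\<lambda>y. l y 0"] exI[of _ "c 0"]) blast
  qed
  then show ?thesis unfolding X_def by blast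
qed

end
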